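(* All isometries of the inhomogeneous Galilean group $Gal(1,3)$ are direct isometries of $Gal(1,3)$.
   Context: An element of an isometry group $\Gamma$ is called a direct isometry of $\Gamma$ when it can be expressed as a (finite) product of squares of elements of $\Gamma$ (square meaning composition with itself); otherwise it is an indirect isometry of $\Gamma$. Elements of the Newton-Cartan spacetime are denoted $(t,x)$ with $t\in\mathbb{R}$ (time) and $x\in\mathbb{R}^3$ (space). $Gal(1,3)$ is the group of transformations of this spacetime generated by: the space and time translations $(t,x)\mapsto(t+s,x+z)$, $s\in\mathbb{R}$, $z\in\mathbb{R}^3$; the spatial rotations $(t,x)\mapsto(t,Rx)$, $R\in SO(3)$; and the Galilean boosts $b_v:(t,x)\mapsto(t,x+tv)$, $v\in\mathbb{R}^3$. (It contains neither parity inversion nor time reversal.) *)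

theory Defs
  imports
    "HOL-Analysis.Determinants"
    "HOL-Algebra.Bij"
    "HOL-Algebra.Elementary_Groups"
begin

type_synonym spacetime = "real \<times> (real ^ 3)"

definition translation :: "real \<Rightarrow> real ^ 3 \<Rightarrow> spacetime \<Rightarrow> spacetime" where
  "translation s z = (\<lambda>(t, x). (t + s, x + z))"

definition spatial_rotation :: "real ^ 3 ^ 3 \<Rightarrow> spacetime \<Rightarrow> spacetime" where
  "spatial_rotation R = (\<lambda>(t, x). (t, R *v x))"

definition boost :: "real ^ 3 \<Rightarrow> spacetime \<Rightarrow> spacetime" where
  "boost v = (\<lambda>(t, x). (t, x + t *\<^sub>R v))"

definition galilean_generators :: "(spacetime \<Rightarrow> spacetime) set" where
  "galilean_generators =
     {translation s z | s z. True}
     \<union> {spatial_rotation R | R. rotation_matrix R}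
     \<union> {boost v | v. True}"

definition Gal :: "(spacetime \<Rightarrow> spacetime) monoid" where
  "Gal = subgroup_generated (BijGroup UNIV) galilean_generators"

(* The empty list gives the empty product, the identity of G. *)
definition direct_isometry :: "('a, 'b) monoid_scheme \<Rightarrow> 'a \<Rightarrow> bool" where
  "direct_isometry G g \<longleftrightarrow>
     (\<exists>hs. set hs \<subseteq> carrier G \<and>
        g = foldr (\<lambda>h p. (h \<otimes>\<^bsub>G\<^esub> h) \<otimes>\<^bsub>G\<^esub> p) hs \<one>\<^bsub>G\<^esub>)"

(* subgroup_generated drops generators outside the carrier of BijGroup, and the
   multiplication of BijGroup is unspecified outside its carrier. Neither matters here:
   the generators are bijections and multiplication in Gal is composition. *)

lemma bij_translation: "bij (translation s z)"
  by (rule o_bij[of "translation (- s) (- z)"]) (auto simp: translation_def fun_eq_iff)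

lemma bij_boost: "bij (boost v)"
  by (rule o_bij[of "boost (- v)"]) (auto simp: boost_def fun_eq_iff)

lemma bij_spatial_rotation:
  assumes "rotation_matrix R"
  shows "bij (spatial_rotation R)"
proof (rule o_bij[of "spatial_rotation (transpose R)"])
  have "transpose R ** R = mat 1" "R ** transpose R = mat 1"
    using assms by (auto simp: rotation_matrix_def orthogonal_matrix_def)
  then show "spatial_rotation (transpose R) \<circ> spatial_rotation R = id"
    and "spatial_rotation R \<circ> spatial_rotation (transpose R) = id"
    by (auto simp: spatial_rotation_def fun_eq_iff matrix_vector_mul_assoc
          simp del: transpose_matrix_vector)
qed

lemma carrier_BijGroup_UNIV: "carrier (BijGroup UNIV) = {f. bij f}"
  by (auto simp: BijGroup_def Bij_def)

lemma galilean_generators_subset: "galilean_generators \<subseteq> carrier (BijGroup UNIV)"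
  by (auto simp: galilean_generators_def carrier_BijGroup_UNIV
      bij_translation bij_boost bij_spatial_rotation)

lemma carrier_Gal: "carrier Gal = generate (BijGroup UNIV) galilean_generators"
  using galilean_generators_subset
  by (simp add: Gal_def carrier_subgroup_generated Int_absorb1)

lemma group_Gal: "group Gal"
  unfolding Gal_def by (rule group.group_subgroup_generated[OF group_BijGroup])

lemma Gal_bij:
  assumes "g \<in> carrier Gal"
  shows "bij g"
  using group.generate_in_carrier[OF group_BijGroup galilean_generators_subset] assms
  by (simp add: carrier_Gal carrier_BijGroup_UNIV)

lemma Gal_one: "\<one>\<^bsub>Gal\<^esub> = id"
  by (auto simp: Gal_def BijGroup_def fun_eq_iff)

lemma Gal_mult:
  assumes "g \<in> carrier Gal" "h \<in> carrier Gal"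
  shows "g \<otimes>\<^bsub>Gal\<^esub> h = g \<circ> h"
  using Gal_bij[OF assms(1)] Gal_bij[OF assms(2)]
  by (auto simp: Gal_def BijGroup_def Bij_def compose_def fun_eq_iff)

end

theory Submission
  imports Defs "HOL-Analysis.Cross3"
begin

unbundle cross3_syntax

text \<open>Translations and boosts are squares of the translation or boost by half the vector. A
  half-turn is the square of a quarter-turn, and every spatial rotation is a product of half-turns:
  the half-turn about the bisector of two vectors of equal norm swaps them, so composing with
  suitable half-turns returns the first two basis vectors to their axes.\<close>

section \<open>Closure properties of direct isometries in an arbitrary group\<close>

lemma (in group) direct_isometry_one: "direct_isometry G \<one>"
  unfolding direct_isometry_def by (intro exI[of _ "[]"]) simp

lemma (in group) direct_isometry_square_mult:
  assumes "h \<in> carrier G" "direct_isometry G g"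
  shows "direct_isometry G ((h \<otimes> h) \<otimes> g)"
proof -
  obtain hs where "set hs \<subseteq> carrier G" "g = foldr (\<lambda>h p. (h \<otimes> h) \<otimes> p) hs \<one>"
    using assms(2) unfolding direct_isometry_def by blast
  with assms(1) show ?thesis
    unfolding direct_isometry_def by (intro exI[of _ "h # hs"]) simp
qed

lemma (in group) direct_isometry_square:
  assumes "h \<in> carrier G"
  shows "direct_isometry G (h \<otimes> h)"
  using direct_isometry_square_mult[OF assms direct_isometry_one] assms by simp

text \<open>List induction along the witness \<open>hs\<close>, stated without the list. Every
  partial product is itself direct and in the carrier, so the step may assume both; membership is
  what \<open>m_assoc\<close> and \<open>inv_mult_group\<close> ask for later.\<close>

lemma (in group) direct_isometry_induct [consumes 1, case_names one square_mult]:
  assumes "direct_isometry G g"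
    and "P \<one>"
    and "\<And>h g. h \<in> carrier G \<Longrightarrow> g \<in> carrier G \<Longrightarrow> direct_isometry G g \<Longrightarrow> P g \<Longrightarrow> P ((h \<otimes> h) \<otimes> g)"
  shows "P g"
proof -
  obtain hs where hs: "set hs \<subseteq> carrier G" and g: "g = foldr (\<lambda>h p. (h \<otimes> h) \<otimes> p) hs \<one>"
    using assms(1) unfolding direct_isometry_def by blast
  define F where "F hs = foldr (\<lambda>h p. (h \<otimes> h) \<otimes> p) hs \<one>" for hs
  from hs have "F hs \<in> carrier G \<and> direct_isometry G (F hs) \<and> P (F hs)"
  proof (induction hs)
    case Nil
    then show ?case using assms(2) by (simp add: F_def direct_isometry_one)
  next
    case (Cons h hs)
    have F_Cons: "F (h # hs) = (h \<otimes> h) \<otimes> F hs" by (simp add: F_def)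
    show ?case
      using Cons assms(3)[of h "F hs"] direct_isometry_square_mult[of h "F hs"]
      by (simp add: F_Cons)
  qed
  then show ?thesis by (simp add: F_def g)
qed

lemma (in group) direct_isometry_closed:
  assumes "direct_isometry G g"
  shows "g \<in> carrier G"
  using assms by (induction rule: direct_isometry_induct) auto

lemma (in group) direct_isometry_mult:
  assumes "direct_isometry G g" "direct_isometry G k"
  shows "direct_isometry G (g \<otimes> k)"
  using assms(1)
proof (induction rule: direct_isometry_induct)
  case one
  then show ?case using assms(2) direct_isometry_closed by simp
next
  case (square_mult h g)
  then show ?case
    using direct_isometry_square_mult[of h "g \<otimes> k"] direct_isometry_closed[OF assms(2)]
    by (simp add: m_assoc)
qed

text \<open>Inversion reverses a product, and the inverse of a square is the square of the
  inverse.\<close>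

lemma (in group) direct_isometry_inv:
  assumes "direct_isometry G g"
  shows "direct_isometry G (inv g)"
  using assms
proof (induction rule: direct_isometry_induct)
  case one
  then show ?case by (simp add: direct_isometry_one)
next
  case (square_mult h g)
  then show ?case
    using direct_isometry_mult[OF square_mult.IH direct_isometry_square[of "inv h"]]
    by (simp add: inv_mult_group)
qed

text \<open>This reduces the theorem to generators: a subgroup containing them contains all they
  generate.\<close>

lemma (in group) subgroup_direct_isometry: "subgroup {g. direct_isometry G g} G"
  by (rule subgroupI)
    (auto intro: direct_isometry_closed direct_isometry_one direct_isometry_inv direct_isometry_mult)

section \<open>Translations and boosts in \<open>Gal\<close>\<close>

lemma galilean_generator_in_Gal:
  assumes "g \<in> galilean_generators"
  shows "g \<in> carrier Gal"
  using assms by (simp add: carrier_Gal generate.incl)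

lemma Gal_direct_square:
  assumes "h \<in> galilean_generators"
  shows "direct_isometry Gal (h \<circ> h)"
  using group.direct_isometry_square[OF group_Gal, of h] galilean_generator_in_Gal[OF assms]
  by (simp add: Gal_mult)

lemma Gal_direct_comp:
  assumes "direct_isometry Gal g" "direct_isometry Gal h"
  shows "direct_isometry Gal (g \<circ> h)"
  using group.direct_isometry_mult[OF group_Gal assms]
    assms[THEN group.direct_isometry_closed[OF group_Gal]]
  by (simp add: Gal_mult)

lemma translation_direct: "direct_isometry Gal (translation s z)"
proof -
  have "translation s z = translation (s / 2) (z /\<^sub>R 2) \<circ> translation (s / 2) (z /\<^sub>R 2)"
    by (auto simp: translation_def fun_eq_iff add.assoc simp flip: scaleR_add_left)
  moreover have "translation (s / 2) (z /\<^sub>R 2) \<in> galilean_generators"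
    unfolding galilean_generators_def by blast
  ultimately show ?thesis using Gal_direct_square by metis
qed

lemma boost_direct: "direct_isometry Gal (boost v)"
proof -
  have "boost v = boost (v /\<^sub>R 2) \<circ> boost (v /\<^sub>R 2)"
    by (auto simp: boost_def fun_eq_iff add.assoc simp flip: scaleR_add_left)
  moreover have "boost (v /\<^sub>R 2) \<in> galilean_generators"
    unfolding galilean_generators_def by blast
  ultimately show ?thesis using Gal_direct_square by metis
qed

lemma spatial_rotation_mult:
  "spatial_rotation (A ** B) = spatial_rotation A \<circ> spatial_rotation B"
  by (auto simp: spatial_rotation_def fun_eq_iff matrix_vector_mul_assoc)

text \<open>Rodrigues' rotation formula about the axis \<open>u\<close> at a right angle, where the
  cosine is 0 and the sine is 1. It is a rotation when \<open>u\<close> is a unit vector.\<close>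

definition quarter_turn :: "real ^ 3 \<Rightarrow> real ^ 3 ^ 3" where
  "quarter_turn u = matrix (\<lambda>x. u \<times> x + (u \<bullet> x) *\<^sub>R u)"

definition half_turn :: "real ^ 3 \<Rightarrow> real ^ 3 ^ 3" where
  "half_turn u = quarter_turn u ** quarter_turn u"

lemma quarter_turn_mult_vec: "quarter_turn u *v x = u \<times> x + (u \<bullet> x) *\<^sub>R u"
proof -
  have "linear (\<lambda>x. u \<times> x + (u \<bullet> x) *\<^sub>R u)"
    by (rule linearI) (simp_all add: cross_add_right cross_mult_right inner_add_right algebra_simps)
  then show ?thesis unfolding quarter_turn_def by (simp add: matrix_vector_mul)
qed

lemma rotation_matrix_quarter_turn:
  assumes "norm u = 1"
  shows "rotation_matrix (quarter_turn u)"
proof -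
  have u: "(u$1)\<^sup>2 + (u$2)\<^sup>2 + (u$3)\<^sup>2 = 1"
    using assms by (simp add: norm_eq_1 inner_vec_def sum_3 power2_eq_square)
  \<comment> \<open>A polynomial identity in the coordinates, valid for every \<open>u\<close>: the
    determinant is the fourth power of the norm.\<close>
  have "det (quarter_turn u) = ((u$1)\<^sup>2 + (u$2)\<^sup>2 + (u$3)\<^sup>2)\<^sup>2"
    by (simp add: quarter_turn_def matrix_def det_3 cross3_def axis_def inner_vec_def sum_3
        power2_eq_square algebra_simps)
  moreover have "orthogonal_matrix (quarter_turn u)"
  proof -
    have "norm (quarter_turn u *v x) = norm x" for x
    proof -
      \<comment> \<open>The two summands are perpendicular because \<open>u \<times> x\<close> is
        perpendicular to \<open>u\<close>. Lagrange's identity then recovers the norm of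
        \<open>x\<close>.\<close>
      have "(norm (quarter_turn u *v x))\<^sup>2 = (norm (u \<times> x))\<^sup>2 + (u \<bullet> x)\<^sup>2"
        using assms unfolding quarter_turn_mult_vec
        by (subst norm_add_Pythagorean) (auto simp: orthogonal_def dot_cross_self power_mult_distrib)
      also have "\<dots> = (norm x)\<^sup>2"
        using norm_cross_dot[of u x] assms by simp
      finally show ?thesis by simp
    qed
    then show ?thesis
      using orthogonal_transformation_matrix[of "(*v) (quarter_turn u)"]
      by (simp add: orthogonal_transformation)
  qed
  ultimately show ?thesis using u by (simp add: rotation_matrix_def)
qed

lemma rotation_matrix_mult:
  fixes A B :: "real ^ 'n ^ 'n"
  assumes "rotation_matrix A" "rotation_matrix B"
  shows "rotation_matrix (A ** B)"
  using assms unfolding rotation_matrix_def by (simp add: orthogonal_matrix_mul det_mul)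

lemma rotation_matrix_half_turn:
  assumes "norm u = 1"
  shows "rotation_matrix (half_turn u)"
  unfolding half_turn_def using rotation_matrix_quarter_turn[OF assms] rotation_matrix_mult by blast

text \<open>Reflection in the line spanned by \<open>u\<close>. The mixed terms of the squared
  quarter-turn vanish, and the triple product expansion rewrites
  \<open>u \<times> (u \<times> x)\<close> as
  \<open>(u \<bullet> x) *\<^sub>R u - x\<close>.\<close>

lemma half_turn_mult_vec:
  assumes "norm u = 1"
  shows "half_turn u *v x = (2 * (u \<bullet> x)) *\<^sub>R u - x"
proof -
  have "u \<bullet> u = 1" using assms by (simp add: norm_eq_1)
  then have "half_turn u *v x = u \<times> (u \<times> x) + (u \<bullet> x) *\<^sub>R u"
    unfolding half_turn_def
    by (simp add: matrix_vector_mul_assoc[symmetric] quarter_turn_mult_vec cross_add_right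
        cross_mult_right inner_add_right dot_cross_self)
  also have "\<dots> = (2 * (u \<bullet> x)) *\<^sub>R u - x"
    using \<open>u \<bullet> u = 1\<close> by (simp add: Lagrange scaleR_2 flip: scaleR_scaleR)
  finally show ?thesis .
qed

lemma half_turn_direct:
  assumes "norm u = 1"
  shows "direct_isometry Gal (spatial_rotation (half_turn u))"
  unfolding half_turn_def spatial_rotation_mult
  using rotation_matrix_quarter_turn[OF assms]
  by (intro Gal_direct_square) (auto simp: galilean_generators_def)

section \<open>Every rotation is a product of half-turns\<close>

lemma half_turn_half_turn:
  assumes "norm u = 1"
  shows "half_turn u ** half_turn u = mat 1"
  using assms
  by (simp add: matrix_eq matrix_vector_mul_assoc[symmetric] half_turn_mult_vec inner_diff_right norm_eq_1)

text \<open>Half-turns are direct involutions, so \<open>R\<close> may be simplified by composing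
  one on the left.\<close>

lemma half_turn_mult_direct_cancel:
  assumes "norm u = 1" "direct_isometry Gal (spatial_rotation (half_turn u ** R))"
  shows "direct_isometry Gal (spatial_rotation R)"
proof -
  have "R = half_turn u ** (half_turn u ** R)"
    by (simp add: matrix_mul_assoc half_turn_half_turn[OF assms(1)])
  then show ?thesis
    using Gal_direct_comp[OF half_turn_direct[OF assms(1)] assms(2)] spatial_rotation_mult by metis
qed

text \<open>With equal norms, the projection of \<open>a\<close> onto the line through
  \<open>a + b\<close> is half of \<open>a + b\<close>; twice it minus \<open>a\<close> is
  \<open>b\<close>. Opposite vectors have no such bisector and are treated separately in each
  use.\<close>

lemma half_turn_bisector:
  assumes "norm a = norm b" "a + b \<noteq> 0"
  defines "u \<equiv> (a + b) /\<^sub>R norm (a + b)"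
  shows "norm u = 1" "half_turn u *v a = b"
proof -
  show u: "norm u = 1" using assms by (simp add: u_def)
  have eq: "b \<bullet> b = a \<bullet> a" using assms(1) by (simp add: norm_eq)
  have n: "(norm (a + b))\<^sup>2 = 2 * ((a + b) \<bullet> a)"
    by (simp add: power2_norm_eq_inner inner_add_left inner_add_right eq inner_commute)
  have "(2 * (u \<bullet> a)) *\<^sub>R u = (2 * ((a + b) \<bullet> a) / (norm (a + b))\<^sup>2) *\<^sub>R (a + b)"
    by (simp add: u_def power2_eq_square divide_inverse ac_simps)
  also have "\<dots> = a + b" using assms(2) unfolding n[symmetric] by simp
  finally show "half_turn u *v a = b"
    by (simp add: half_turn_mult_vec[OF u])
qed

text \<open>Rotations preserve cross products, so the images of the first two basis vectors
  determine that of the third.\<close>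

lemma rotation_matrix_eqI:
  fixes A B :: "real ^ 3 ^ 3"
  assumes "rotation_matrix A" "rotation_matrix B"
    and "A *v axis 1 1 = B *v axis 1 1" "A *v axis 2 1 = B *v axis 2 1"
  shows "A = B"
proof -
  have "axis 3 1 = axis 1 1 \<times> (axis 2 1 :: real ^ 3)" by (simp add: cross_basis)
  then have "A *v axis 3 1 = B *v axis 3 1"
    using assms by (metis cross_rotation_matrix)
  then have "column i A = column i B" for i
    using assms(3,4) exhaust_3[of i] by (auto simp: matrix_vector_mult_basis)
  then show ?thesis by (simp add: vec_eq_iff column_def)
qed

lemma spatial_rotation_direct_if_fixes_axis:
  assumes R: "rotation_matrix R" and R1: "R *v axis 1 1 = axis 1 1"
  shows "direct_isometry Gal (spatial_rotation R)"
proof -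
  define a where "a = R *v axis 2 1"
  have orth: "orthogonal_transformation ((*v) R)"
    using R by (simp add: rotation_matrix_def orthogonal_transformation_matrix)
  have norm_a: "norm a = norm (axis 2 1 :: real ^ 3)"
    unfolding a_def using orth by (rule orthogonal_transformation_norm)
  have "axis 1 1 \<bullet> a = axis 1 1 \<bullet> (axis 2 1 :: real ^ 3)"
    unfolding a_def using orth R1 by (metis orthogonal_transformation_def)
  then have a1: "axis 1 1 \<bullet> a = 0" by (simp add: inner_axis_axis)
  show ?thesis
  proof (cases "a + axis 2 1 = 0")
    case True
    \<comment> \<open>Here \<open>R\<close> fixes the first basis vector and negates the
      second.\<close>
    have "R = half_turn (axis 1 1)"
    proof (rule rotation_matrix_eqI[OF R rotation_matrix_half_turn])
      show "R *v axis 2 1 = half_turn (axis 1 1) *v axis 2 1"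
        using True by (simp add: half_turn_mult_vec inner_axis_axis a_def eq_neg_iff_add_eq_0)
    qed (simp_all add: R1 half_turn_mult_vec inner_axis_axis scaleR_2)
    then show ?thesis using half_turn_direct by simp
  next
    case False
    define u where "u = (a + axis 2 1) /\<^sub>R norm (a + axis 2 1)"
    have u: "norm u = 1" "half_turn u *v a = axis 2 1"
      using half_turn_bisector[OF norm_a False] by (auto simp: u_def)
    have u1: "u \<bullet> axis 1 1 = 0"
      using a1 by (simp add: u_def inner_add_right inner_axis_axis inner_commute[of _ "axis 1 1"])
    \<comment> \<open>Since \<open>u\<close> is perpendicular to the first axis, its half-turn
      negates the first basis vector while bringing \<open>a\<close> back to the second. The product
      therefore acts on both as the half-turn about the second axis.\<close>
    have "half_turn u ** R = half_turn (axis 2 1)"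
    proof (rule rotation_matrix_eqI)
      show "rotation_matrix (half_turn u ** R)"
        using R rotation_matrix_half_turn[OF u(1)] by (rule rotation_matrix_mult[rotated])
      show "(half_turn u ** R) *v axis 1 1 = half_turn (axis 2 1) *v axis 1 1"
        using u1 by (simp add: R1 matrix_vector_mul_assoc[symmetric] half_turn_mult_vec u(1)
            inner_axis_axis)
      show "(half_turn u ** R) *v axis 2 1 = half_turn (axis 2 1) *v axis 2 1"
        using u(2) by (simp add: matrix_vector_mul_assoc[symmetric] half_turn_mult_vec
            inner_axis_axis a_def scaleR_2)
    qed (simp add: rotation_matrix_half_turn)
    then show ?thesis
      using half_turn_mult_direct_cancel[OF u(1)] half_turn_direct[of "axis 2 1"] by simp
  qed
qed

lemma spatial_rotation_direct:
  assumes R: "rotation_matrix R"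
  shows "direct_isometry Gal (spatial_rotation R)"
proof -
  define a where "a = R *v axis 1 1"
  have "orthogonal_transformation ((*v) R)"
    using R by (simp add: rotation_matrix_def orthogonal_transformation_matrix)
  then have norm_a: "norm a = norm (axis 1 1 :: real ^ 3)"
    unfolding a_def by (rule orthogonal_transformation_norm)
  obtain u where u: "norm u = 1" "half_turn u *v a = axis 1 1"
  proof (cases "a + axis 1 1 = 0")
    case True
    then have "a = - axis 1 1" by (simp add: eq_neg_iff_add_eq_0)
    then show ?thesis
      \<comment> \<open>A half-turn about any axis perpendicular to \<open>a\<close> negates
        \<open>a\<close>; the second axis is one choice.\<close>
      using that[of "axis 2 1"] by (simp add: half_turn_mult_vec inner_axis_axis)
  next
    case False
    then show ?thesis using half_turn_bisector[OF norm_a] that by blast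
  qed
  have "direct_isometry Gal (spatial_rotation (half_turn u ** R))"
  proof (rule spatial_rotation_direct_if_fixes_axis)
    show "rotation_matrix (half_turn u ** R)"
      using R rotation_matrix_half_turn[OF u(1)] by (rule rotation_matrix_mult[rotated])
    show "(half_turn u ** R) *v axis 1 1 = axis 1 1"
      using u(2) by (simp add: matrix_vector_mul_assoc[symmetric] a_def)
  qed
  then show ?thesis by (rule half_turn_mult_direct_cancel[OF u(1)])
qed

theorem theorem8:
  shows "\<forall>g \<in> carrier Gal. direct_isometry Gal g"
proof -
  let ?D = "{g. direct_isometry Gal g}"
  \<comment> \<open>Writing \<open>Gal\<close> as \<open>BijGroup UNIV\<close> with a smaller
    carrier lets \<open>incl_subgroup\<close> turn a subgroup of \<open>Gal\<close> into one of
    \<open>BijGroup UNIV\<close>, the group in which \<open>generate\<close> is taken.\<close>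
  have Gal_eq: "Gal = BijGroup UNIV \<lparr>carrier := generate (BijGroup UNIV) galilean_generators\<rparr>"
    using galilean_generators_subset
    by (simp add: Gal_def subgroup_generated_def Int_absorb1)
  have "subgroup ?D (BijGroup UNIV)"
    using group.incl_subgroup[OF group_BijGroup
        group.generate_is_subgroup[OF group_BijGroup galilean_generators_subset]]
      group.subgroup_direct_isometry[OF group_Gal] Gal_eq by metis
  moreover have "galilean_generators \<subseteq> ?D"
    by (auto simp: galilean_generators_def translation_direct boost_direct spatial_rotation_direct)
  ultimately have "carrier Gal \<subseteq> ?D"
    unfolding carrier_Gal by (intro group.generate_subgroup_incl[OF group_BijGroup])
  then show ?thesis by blast
qed

end
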